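(* For any connected graphs $G$ and $H$, $$\operatorname{th}_{\rm pd}^{\times}(G\Box H)\le\operatorname{th}_{\rm pd}^{\times}(G)\,|V(H)|\quad\text{and}\quad\operatorname{th}_{\rm pd}^{\times}(G\Box H)\le\operatorname{th}_{\rm pd}^{\times}(H)\,|V(G)|.$$
   Context: All graphs are finite, simple and undirected with at least one vertex. The Cartesian product $G\Box H$ has vertex set $V(G)\times V(H)$, with $(x_1,y_1)$ and $(x_2,y_2)$ adjacent if either $x_1=x_2$ and $y_1y_2\in E(H)$, or $y_1=y_2$ and $x_1x_2\in E(G)$. Let $G$ be a graph and let $N[S]$ denote the closed neighborhood of $S\subseteq V(G)$. For nonempty $S\subseteq V(G)$ define $P^{[0]}(S)=S$, $P^{[1]}(S)=N[S]$, and for $i\ge 1$, $P^{[i+1]}(S)=P^{[i]}(S)\cup\{w\in V(G)\setminus P^{[i]}(S): \exists u\in P^{[i]}(S),\ N(u)\setminus P^{[i]}(S)=\{w\}\}$. $S$ is a power dominating set if $P^{[t]}(S)=V(G)$ for some $t$. The power propagation time $\operatorname{pt}_{\rm pd}(G;S)$ is the least positive integer $t$ with $P^{[t]}(S)=V(G)$ (so it is at least $1$, even for $S=V(G)$), and is $\infty$ if $S$ is not a power dominating set. The product power throttling number is $\operatorname{th}_{\rm pd}^{\times}(G)=\min_{\emptyset\ne S\subseteq V(G)}|S|\operatorname{pt}_{\rm pd}(G;S)$. *)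

theory Defs
  imports "Graph_Theory.Digraph_Component" "HOL-Library.Extended_Nat"
begin

text \<open>
  A finite simple undirected graph is a \<^locale>\<open>pair_graph\<close>: its vertex set is finite, and its
  edge set is a symmetric irreflexive relation in which the edge \<open>uv\<close> is represented by the two
  pairs \<open>(u, v)\<close> and \<open>(v, u)\<close>. The locale admits the graph without vertices, whereas
  \<^const>\<open>connected\<close> requires at least one vertex.
\<close>

definition neighborhood :: "'a pair_pre_digraph \<Rightarrow> 'a \<Rightarrow> 'a set" where
  "neighborhood G u = {v. (u, v) \<in> parcs G}"

definition closed_neighborhood :: "'a pair_pre_digraph \<Rightarrow> 'a set \<Rightarrow> 'a set" where
  "closed_neighborhood G S = S \<union> (\<Union>u\<in>S. neighborhood G u)"

definition cartesian_product ::
    "'a pair_pre_digraph \<Rightarrow> 'b pair_pre_digraph \<Rightarrow> ('a \<times> 'b) pair_pre_digraph" where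
  "cartesian_product G H =
    \<lparr> pverts = pverts G \<times> pverts H,
      parcs = {((x1, y1), (x2, y2)) | x1 y1 x2 y2.
        (x1 = x2 \<and> x1 \<in> pverts G \<and> (y1, y2) \<in> parcs H) \<or>
        (y1 = y2 \<and> y1 \<in> pverts H \<and> (x1, x2) \<in> parcs G)} \<rparr>"

fun power_propagation :: "'a pair_pre_digraph \<Rightarrow> 'a set \<Rightarrow> nat \<Rightarrow> 'a set" where
  "power_propagation G S 0 = S"
| "power_propagation G S (Suc 0) = closed_neighborhood G S"
| "power_propagation G S (Suc (Suc i)) =
    power_propagation G S (Suc i) \<union>
    {w \<in> pverts G - power_propagation G S (Suc i).
      \<exists>u \<in> power_propagation G S (Suc i).
        neighborhood G u - power_propagation G S (Suc i) = {w}}"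

definition power_dominating_set :: "'a pair_pre_digraph \<Rightarrow> 'a set \<Rightarrow> bool" where
  "power_dominating_set G S \<longleftrightarrow>
    S \<noteq> {} \<and> S \<subseteq> pverts G \<and> (\<exists>t. power_propagation G S t = pverts G)"

text \<open>
  Only positive times count, so the value is at least 1. A time with the required property exists
  for every power dominating set: if time 0 has it, then so does time 1.
\<close>

definition power_propagation_time :: "'a pair_pre_digraph \<Rightarrow> 'a set \<Rightarrow> enat" where
  "power_propagation_time G S =
    (if power_dominating_set G S
     then enat (LEAST t. 0 < t \<and> power_propagation G S t = pverts G)
     else \<infinity>)"

definition product_power_throttling_number :: "'a pair_pre_digraph \<Rightarrow> enat" where
  "product_power_throttling_number G =
    Min ((\<lambda>S. enat (card S) * power_propagation_time G S) ` {S. S \<noteq> {} \<and> S \<subseteq> pverts G})"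

end

theory Submission
  imports Defs
begin

text \<open>
  Power propagation in a Cartesian product commutes with taking full fibres: a vertex \<open>(u, y)\<close> of
  \<open>A \<times> V(H)\<close> has all its neighbours in its own \<open>H\<close>-fibre inside \<open>A \<times> V(H)\<close>, so its neighbours
  outside that set are \<open>(N(u) - A) \<times> {y}\<close>. Hence \<open>S \<times> V(H)\<close> propagates in the product exactly as
  \<open>S\<close> does in \<open>G\<close>.
\<close>

lemma pverts_cartesian_product:
  "pverts (cartesian_product G H) = pverts G \<times> pverts H"
  by (simp add: cartesian_product_def)

lemma neighborhood_cartesian_product:
  "neighborhood (cartesian_product G H) (x, y) =
    {v. x \<in> pverts G \<and> fst v = x \<and> snd v \<in> neighborhood H y} \<union>
    {v. y \<in> pverts H \<and> snd v = y \<and> fst v \<in> neighborhood G x}"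
  by (auto simp: neighborhood_def cartesian_product_def)

lemma neighborhood_subset:
  assumes "pair_wf_digraph G"
  shows "neighborhood G u \<subseteq> pverts G"
  using pair_wf_digraph.in_arcsD2[OF assms] by (auto simp: neighborhood_def)

lemma power_propagation_subset:
  assumes "pair_wf_digraph G" "S \<subseteq> pverts G"
  shows "power_propagation G S t \<subseteq> pverts G"
  using assms
proof (induction G S t rule: power_propagation.induct)
  case (2 G S)
  then show ?case
    using neighborhood_subset[of G] by (auto simp: closed_neighborhood_def)
qed auto

lemma neighborhood_times_verts_Diff:
  assumes "pair_wf_digraph H" "A \<subseteq> pverts G" "u \<in> A" "y \<in> pverts H"
  shows "neighborhood (cartesian_product G H) (u, y) - A \<times> pverts H =
    (neighborhood G u - A) \<times> {y}"
  using assms neighborhood_subset[of H y]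
  by (auto simp: neighborhood_cartesian_product)

lemma neighborhood_verts_times_Diff:
  assumes "pair_wf_digraph G" "A \<subseteq> pverts H" "u \<in> A" "x \<in> pverts G"
  shows "neighborhood (cartesian_product G H) (x, u) - pverts G \<times> A =
    {x} \<times> (neighborhood H u - A)"
  using assms neighborhood_subset[of G x]
  by (auto simp: neighborhood_cartesian_product)

text \<open>Carries the forcing condition between product and factor: a fibrewise set of outside
  neighbours is a single vertex exactly when its projection is, and that vertex then stays in the
  layer of the forcing vertex.\<close>

lemma singleton_times_iff:
  "A \<times> {y} = {(w, z)} \<longleftrightarrow> A = {w} \<and> y = z"
  "{y} \<times> A = {(z, w)} \<longleftrightarrow> A = {w} \<and> y = z"
  by auto

lemma power_propagation_times_verts:
  assumes "pair_wf_digraph G" "pair_wf_digraph H" "S \<subseteq> pverts G"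
  shows "power_propagation (cartesian_product G H) (S \<times> pverts H) t =
    power_propagation G S t \<times> pverts H"
  using assms
proof (induction G S t rule: power_propagation.induct)
  case (2 G S)
  then show ?case
    \<comment> \<open>Domination step: neighbours along \<open>H\<close> stay inside
      \<open>S \<times> pverts H\<close>, and neighbours along \<open>G\<close> reach every copy of
      each neighbour of \<open>S\<close>.\<close>
    using neighborhood_subset[of H]
    by (fastforce simp: closed_neighborhood_def neighborhood_cartesian_product)
next
  case (3 G S i)
  let ?A = "power_propagation G S (Suc i)"
  have "?A \<subseteq> pverts G"
    using power_propagation_subset 3 by blast
  \<comment> \<open>The forcing vertex of \<open>(w, z)\<close> must have the form
    \<open>(u, z)\<close> with \<open>u\<close> forcing \<open>w\<close> in \<open>G\<close>.
    Conversely \<open>(u, z)\<close> forces \<open>(w, z)\<close> for every vertex \<open>z\<close>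
    of \<open>H\<close>, so all copies of \<open>w\<close> are added in the same round.\<close>
  with 3 have step: "(\<exists>u\<in>?A \<times> pverts H.
      neighborhood (cartesian_product G H) u - ?A \<times> pverts H = {(w, z)}) \<longleftrightarrow>
      (\<exists>u\<in>?A. neighborhood G u - ?A = {w}) \<and> z \<in> pverts H" for w z
    by (auto simp: neighborhood_times_verts_Diff singleton_times_iff)
  show ?case
  proof (rule set_eqI)
    fix v
    show "v \<in> power_propagation (cartesian_product G H) (S \<times> pverts H) (Suc (Suc i)) \<longleftrightarrow>
        v \<in> power_propagation G S (Suc (Suc i)) \<times> pverts H"
      using 3 step by (cases v) (simp add: pverts_cartesian_product, blast)
  qed
qed simp

text \<open>Mirror image with the factors exchanged; repeating the argument avoids showing that
  propagation is invariant under the swap isomorphism.\<close>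

lemma power_propagation_verts_times:
  assumes "pair_wf_digraph G" "pair_wf_digraph H" "S \<subseteq> pverts H"
  shows "power_propagation (cartesian_product G H) (pverts G \<times> S) t =
    pverts G \<times> power_propagation H S t"
  using assms
proof (induction H S t rule: power_propagation.induct)
  case (2 H S)
  then show ?case
    using neighborhood_subset[of G]
    by (fastforce simp: closed_neighborhood_def neighborhood_cartesian_product)
next
  case (3 H S i)
  let ?A = "power_propagation H S (Suc i)"
  have "?A \<subseteq> pverts H"
    using power_propagation_subset 3 by blast
  with 3 have step: "(\<exists>u\<in>pverts G \<times> ?A.
      neighborhood (cartesian_product G H) u - pverts G \<times> ?A = {(z, w)}) \<longleftrightarrow>
      (\<exists>u\<in>?A. neighborhood H u - ?A = {w}) \<and> z \<in> pverts G" for w z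
    by (auto simp: neighborhood_verts_times_Diff singleton_times_iff)
  show ?case
  proof (rule set_eqI)
    fix v
    show "v \<in> power_propagation (cartesian_product G H) (pverts G \<times> S) (Suc (Suc i)) \<longleftrightarrow>
        v \<in> pverts G \<times> power_propagation H S (Suc (Suc i))"
      using 3 step by (cases v) (simp add: pverts_cartesian_product, blast)
  qed
qed simp

text \<open>Every positive time that completes \<open>S\<close> also completes \<open>T\<close>, so
  the least one for \<open>T\<close> comes no later. If \<open>S\<close> is not power dominating,
  the bound is infinite.\<close>

lemma power_propagation_time_mono:
  assumes "pair_wf_digraph G" "T \<noteq> {}" "T \<subseteq> pverts K"
    and "\<And>t. power_propagation G S t = pverts G \<Longrightarrow> power_propagation K T t = pverts K"
  shows "power_propagation_time K T \<le> power_propagation_time G S"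
proof (cases "power_dominating_set G S")
  case True
  then obtain t where t: "power_propagation G S t = pverts G"
    and "S \<subseteq> pverts G"
    by (auto simp: power_dominating_set_def)
  have "\<exists>t>0. power_propagation G S t = pverts G"
  proof (cases t)
    \<comment> \<open>Here \<open>S\<close> is all of \<open>pverts G\<close>. Only positive times
      compete for the minimum, so time 1 serves as witness: the closed neighborhood contains
      \<open>S\<close> and stays within \<open>pverts G\<close>.\<close>
    case 0
    then have "power_propagation G S 1 = pverts G"
      using t power_propagation_subset[OF assms(1) \<open>S \<subseteq> pverts G\<close>, of 1]
      by (auto simp: closed_neighborhood_def)
    then show ?thesis by blast
  qed (use t in blast)
  then have "0 < (LEAST t. 0 < t \<and> power_propagation G S t = pverts G) \<and>
      power_propagation G S (LEAST t. 0 < t \<and> power_propagation G S t = pverts G) = pverts G"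
    by (rule LeastI_ex)
  moreover have "power_dominating_set K T"
    using assms t by (auto simp: power_dominating_set_def)
  ultimately show ?thesis
    using True assms(4) by (simp add: power_propagation_time_def Least_le)
qed (simp add: power_propagation_time_def)

text \<open>Common core of both bounds: \<open>K\<close> stands for the product, \<open>f\<close>
  sends a set to its union of fibres, and \<open>n\<close> is the size of a fibre. An optimal
  \<open>S\<close> for \<open>G\<close> yields the competitor \<open>f S\<close> for
  \<open>K\<close>.\<close>

lemma product_power_throttling_number_le_mult:
  assumes wf: "pair_wf_digraph G" and "finite (pverts G)" "pverts G \<noteq> {}" "finite (pverts K)"
    and f: "\<And>S. S \<noteq> {} \<Longrightarrow> S \<subseteq> pverts G \<Longrightarrow> f S \<noteq> {} \<and> f S \<subseteq> pverts K \<and> card (f S) = card S * n"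
    and full: "\<And>S t. S \<subseteq> pverts G \<Longrightarrow> power_propagation G S t = pverts G \<Longrightarrow>
      power_propagation K (f S) t = pverts K"
  shows "product_power_throttling_number K \<le> product_power_throttling_number G * enat n"
proof -
  let ?c = "\<lambda>S. enat (card S) * power_propagation_time G S"
  \<comment> \<open>The minimum is attained, since the nonempty subsets of a finite nonempty vertex
    set form a finite nonempty family.\<close>
  have "product_power_throttling_number G \<in> ?c ` {S. S \<noteq> {} \<and> S \<subseteq> pverts G}"
    unfolding product_power_throttling_number_def using assms(2,3) by (intro Min_in) auto
  then obtain S where S: "S \<noteq> {}" "S \<subseteq> pverts G" "product_power_throttling_number G = ?c S"
    by auto
  have "product_power_throttling_number K \<le> enat (card (f S)) * power_propagation_time K (f S)"
    unfolding product_power_throttling_number_def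
    using assms(4) f[OF S(1,2)] by (intro Min_le imageI) auto
  also have "\<dots> \<le> enat (card (f S)) * power_propagation_time G S"
    using wf f[OF S(1,2)] full[OF S(2)] by (intro mult_left_mono power_propagation_time_mono) auto
  also have "\<dots> = product_power_throttling_number G * enat n"
    \<comment> \<open>Splitting \<open>enat (card S * n)\<close> into a product of
      \<open>enat\<close> values lets the factor \<open>n\<close> move past the propagation time,
      even if that is infinite.\<close>
    using f[OF S(1,2)] S(3) by (simp flip: times_enat_simps(1) add: mult_ac)
  finally show ?thesis .
qed

theorem theorem6p1:
  fixes G :: "'a pair_pre_digraph" and H :: "'b pair_pre_digraph"
  assumes "pair_graph G" and "Digraph_Component.connected (with_proj G)"
    and "pair_graph H" and "Digraph_Component.connected (with_proj H)"
  shows "product_power_throttling_number (cartesian_product G H)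
           \<le> product_power_throttling_number G * enat (card (pverts H))
       \<and> product_power_throttling_number (cartesian_product G H)
           \<le> product_power_throttling_number H * enat (card (pverts G))"
proof -
  interpret G: pair_graph G by fact
  interpret H: pair_graph H by fact
  \<comment> \<open>Connectedness includes having a vertex. Hence the minima range over nonempty
    families, and the fibres over a nonempty set are nonempty.\<close>
  have ne: "pverts G \<noteq> {}" "pverts H \<noteq> {}"
    using assms(2,4) by (auto simp: Digraph_Component.connected_def strongly_connected_def)
  have wf: "pair_wf_digraph G" "pair_wf_digraph H"
    by unfold_locales
  show ?thesis
  proof
    show "product_power_throttling_number (cartesian_product G H)
        \<le> product_power_throttling_number G * enat (card (pverts H))"
      by (rule product_power_throttling_number_le_mult[where f = "\<lambda>S. S \<times> pverts H"])
        (use ne wf in \<open>auto simp: pverts_cartesian_product card_cartesian_product power_propagation_times_verts\<close>)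
    show "product_power_throttling_number (cartesian_product G H)
        \<le> product_power_throttling_number H * enat (card (pverts G))"
      by (rule product_power_throttling_number_le_mult[where f = "\<lambda>S. pverts G \<times> S"])
        (use ne wf in \<open>auto simp: pverts_cartesian_product card_cartesian_product power_propagation_verts_times\<close>)
  qed
qed

end
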